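(* There exists a constant $c_1>3.1\cdot 10^{-8}$ such that for any positive integers $(n_j)_{j\ge1}$ satisfying $n_{j+1}/n_j\ge 3$ for all $j\ge 1$, for any vectors $v_0,v_1,\ldots$ in a normed space $(E,\|\cdot\|)$ and every integer $N\ge 0$, $$\int_{\mathbb{T}}\Big\|\sum_{j=0}^N v_jR_j\Big\|\,\mathrm{d}m\ \ge\ c_1\sum_{j=0}^N\|v_j\| .$$
   Context: $\mathbb{T}=\mathbb{R}/2\pi\mathbb{Z}$ is the one-dimensional torus and $m$ is the normalized Haar measure on $\mathbb{T}$. For a sequence $(n_j)_{j\ge1}$ of positive integers, the Riesz products are $R_0\equiv 1$ and $R_N(t)=\prod_{j=1}^N(1+\cos(n_jt))$ for $N=1,2,\ldots$. The constant $c_1$ is universal (independent of $(n_j)$, $E$, $v_j$, $N$). *)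

theory Defs
  imports "HOL-Analysis.Analysis"
begin

text \<open>The torus is represented by the fundamental domain \<open>[0, 2\<pi>)\<close>; functions on it are
  \<open>2\<pi>\<close>-periodic functions on the reals.\<close>

definition torus_haar :: "real measure" where
  "torus_haar = uniform_measure lborel {0..<2 * pi}"

text \<open>Sequences \<open>(n\<^sub>j)\<close> are indexed from \<open>1\<close>; the value at \<open>0\<close> is irrelevant.\<close>

definition lacunary3 :: "(nat \<Rightarrow> nat) \<Rightarrow> bool" where
  "lacunary3 n \<longleftrightarrow> (\<forall>j\<ge>1. n j > 0) \<and> (\<forall>j\<ge>1. real (n (j + 1)) / real (n j) \<ge> 3)"

definition riesz_product :: "(nat \<Rightarrow> nat) \<Rightarrow> nat \<Rightarrow> real \<Rightarrow> real" where
  "riesz_product n N t = (\<Prod>j = 1..N. 1 + cos (real (n j) * t))"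

definition seq_seminorm :: "((nat \<Rightarrow> real) \<Rightarrow> real) \<Rightarrow> bool" where
  "seq_seminorm q \<longleftrightarrow>
     (\<forall>x y. q (\<lambda>j. x j + y j) \<le> q x + q y) \<and> (\<forall>a x. q (\<lambda>j. a * x j) = \<bar>a\<bar> * q x)"

text \<open>A constant that serves all normed spaces simultaneously. HOL cannot quantify over types
  below an existential quantifier, so ``there is a constant such that for every normed space''
  is expressed through a closed constant, about which a statement polymorphic in the space can
  then be made. It is the largest constant valid in all normed spaces: for fixed vectors
  \<open>v\<^sub>0, \<dots>, v\<^sub>N\<close> the norm enters the inequality only through the seminorm
  \<open>x \<mapsto> \<parallel>\<Sum>j\<le>N. x\<^sub>j v\<^sub>j\<parallel>\<close> on coefficient sequences, and every seminorm on
  sequences arises in this way (for finitely many coefficients) by passing to the quotient by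
  its kernel, with \<open>v\<^sub>j\<close> the class of the \<open>j\<close>-th unit sequence.\<close>

definition riesz_c1 :: real where
  "riesz_c1 = Sup {c. \<forall>n q N. lacunary3 n \<longrightarrow> seq_seminorm q \<longrightarrow>
     (\<integral>t. q (\<lambda>j. if j \<le> N then riesz_product n j t else 0) \<partial>torus_haar)
       \<ge> c * (\<Sum>j = 0..N. q (\<lambda>i. if i = j then 1 else 0))}"

end

theory Submission
  imports Defs
begin

text \<open>
  The integral over the torus dominates an average over fair coins, and for coins the inequality
  follows from an exchange symmetry.

  Transfer to coins. Let \<open>y\<^sub>k\<close> take the values \<open>1/2\<close> and \<open>3/2\<close> with probability one half. For each
  outcome \<open>y\<close> the kernel \<open>\<Prod>\<^sub>k (1 + 2 (y\<^sub>k - 1) cos (n\<^sub>k t))\<close> is nonnegative, its average over \<open>y\<close> is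
  identically \<open>1\<close>, and its scalar product with \<open>R\<^sub>j\<close> is \<open>y\<^sub>1 \<cdots> y\<^sub>j\<close>. The last point is where
  \<open>n\<^sub>j\<^sub>+\<^sub>1 \<ge> 3 n\<^sub>j\<close> enters: it makes \<open>n\<^sub>k > 2 (n\<^sub>1 + \<dots> + n\<^sub>k\<^sub>-\<^sub>1)\<close>, so that a product of cosine polynomials
  of degree at most two in the variables \<open>n\<^sub>k t\<close> has the mean it would have if these variables were
  independent (\<open>cosine_product_mean\<close>). By convexity of the norm
  (\<open>seminorm_torus_integral_le\<close>), the average of \<open>\<parallel>\<Sum>\<^sub>j (y\<^sub>1 \<cdots> y\<^sub>j) v\<^sub>j\<parallel>\<close> over the coins is at most
  \<open>\<integral> \<parallel>\<Sum>\<^sub>j R\<^sub>j v\<^sub>j\<parallel>\<close> (\<open>coin_avg_le_torus_integral\<close>). An additional coin \<open>y\<^sub>0\<close>, which only multiplies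
  everything by an independent factor of mean \<open>1\<close>, and one coin after the last make all
  positions alike.

  Coins. Write \<open>P\<^sub>k = y\<^sub>0 \<cdots> y\<^sub>k\<^sub>-\<^sub>1\<close> and \<open>F = \<Sum>\<^sub>j P\<^sub>j\<^sub>+\<^sub>1 v\<^sub>j\<close>. Exchanging \<open>y\<^sub>i\<close> and \<open>y\<^sub>i\<^sub>+\<^sub>1\<close> preserves the
  distribution and changes no partial product except \<open>P\<^sub>i\<^sub>+\<^sub>1\<close>. The difference of \<open>F\<close> before and after
  the exchange is therefore \<open>P\<^sub>i (y\<^sub>i - y\<^sub>i\<^sub>+\<^sub>1) v\<^sub>i\<close>, which isolates a single vector. These estimates can
  be added over all \<open>i\<close> at bounded cost if they are weighted by \<open>w\<^sub>i = P\<^sub>i / \<Sum>\<^sub>k P\<^sub>k\<close>: the weights sum to at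
  most \<open>1\<close>, and an exchange changes each by a factor of at most \<open>3\<close>. It remains to bound the average
  of \<open>P\<^sub>i\<^sup>2 (y\<^sub>i - y\<^sub>i\<^sub>+\<^sub>1)\<^sup>2 / \<Sum>\<^sub>k P\<^sub>k\<close> from below independently of the number of coins
  (\<open>coin_avg_swap_gain\<close>). Under the probability measure with density \<open>P\<^sub>i\<close> the ratio
  \<open>\<Sum>\<^sub>k P\<^sub>k / P\<^sub>i\<close> is typically bounded, because the average of \<open>sqrt (P\<^sub>i P\<^sub>k)\<close>
  decays geometrically in \<open>\<bar>i - k\<bar>\<close>, at the rate given by the mean of \<open>sqrt y\<^sub>0\<close>, which is less
  than one. Numerically this gives the constant \<open>1/115200 > 8 \<cdot> 10\<^sup>-\<^sup>6\<close>.
\<close>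

section \<open>Seminorms on coefficient sequences\<close>

lemma seq_seminorm_triangle: "seq_seminorm q \<Longrightarrow> q (\<lambda>j. x j + y j) \<le> q x + q y"
  by (simp add: seq_seminorm_def)

lemma seq_seminorm_scale: "seq_seminorm q \<Longrightarrow> q (\<lambda>j. a * x j) = \<bar>a\<bar> * q x"
  by (simp add: seq_seminorm_def)

lemma seq_seminorm_zero: "seq_seminorm q \<Longrightarrow> q (\<lambda>j. 0) = 0"
  using seq_seminorm_scale[of q 0] by simp

lemma seq_seminorm_diff:
  assumes "seq_seminorm q"
  shows "q (\<lambda>j. x j - y j) \<le> q x + q y"
  using seq_seminorm_triangle[OF assms, of x "\<lambda>j. (- 1) * y j"]
    seq_seminorm_scale[OF assms, of "- 1" y] by simp

lemma seq_seminorm_nonneg: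
  assumes "seq_seminorm q"
  shows "q x \<ge> 0"
  using seq_seminorm_diff[OF assms, of x x] seq_seminorm_zero[OF assms] by simp

lemma seq_seminorm_sum:
  assumes "seq_seminorm q" "finite A"
  shows "q (\<lambda>j. \<Sum>a\<in>A. x a j) \<le> (\<Sum>a\<in>A. q (x a))"
  using assms(2)
proof (induction A rule: finite_induct)
  case empty
  then show ?case by (simp add: seq_seminorm_zero[OF assms(1)])
next
  case (insert a A)
  then show ?case
    using seq_seminorm_triangle[OF assms(1), of "x a" "\<lambda>j. \<Sum>a\<in>A. x a j"] by simp
qed

abbreviation unit_seq :: "nat \<Rightarrow> nat \<Rightarrow> real" where
  "unit_seq j \<equiv> (\<lambda>i. if i = j then 1 else 0)"

abbreviation truncate :: "nat \<Rightarrow> (nat \<Rightarrow> real) \<Rightarrow> nat \<Rightarrow> real" where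
  "truncate N x \<equiv> (\<lambda>j. if j \<le> N then x j else 0)"

lemma seq_seminorm_le_coordinates:
  assumes "seq_seminorm q"
  shows "q (truncate N x) \<le> (\<Sum>i\<le>N. \<bar>x i\<bar> * q (unit_seq i))"
proof -
  have "(\<lambda>j. \<Sum>i\<le>N. x i * unit_seq i j) = truncate N x"
    by (auto simp: fun_eq_iff sum.delta if_distrib cong: if_cong)
  then have "q (truncate N x) = q (\<lambda>j. \<Sum>i\<le>N. x i * unit_seq i j)" by simp
  also have "\<dots> \<le> (\<Sum>i\<le>N. q (\<lambda>j. x i * unit_seq i j))"
    by (rule seq_seminorm_sum[OF assms]) simp
  also have "\<dots> = (\<Sum>i\<le>N. \<bar>x i\<bar> * q (unit_seq i))"
    by (intro sum.cong refl seq_seminorm_scale[OF assms])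
  finally show ?thesis .
qed

lemma seq_seminorm_truncate_dist:
  assumes "seq_seminorm q"
  shows "\<bar>q (truncate N x) - q (truncate N y)\<bar> \<le> (\<Sum>i\<le>N. \<bar>x i - y i\<bar> * q (unit_seq i))"
proof -
  have *: "q (truncate N x) \<le> q (truncate N y) + (\<Sum>i\<le>N. \<bar>x i - y i\<bar> * q (unit_seq i))" for x y
  proof -
    have "(\<lambda>j. truncate N y j + truncate N (\<lambda>j. x j - y j) j) = truncate N x"
      by (auto simp: fun_eq_iff)
    then show ?thesis
      using seq_seminorm_triangle[OF assms, of "truncate N y" "truncate N (\<lambda>j. x j - y j)"]
        seq_seminorm_le_coordinates[OF assms, of N "\<lambda>j. x j - y j"] by simp
  qed
  have "(\<Sum>i\<le>N. \<bar>y i - x i\<bar> * q (unit_seq i)) = (\<Sum>i\<le>N. \<bar>x i - y i\<bar> * q (unit_seq i))"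
    by (simp add: abs_minus_commute)
  then show ?thesis using *[of x y] *[of y x] by linarith
qed

text \<open>On sequences supported in a fixed finite set a seminorm is Lipschitz for the weighted
  \<open>\<ell>\<^sup>1\<close>-norm, so it is continuous for coordinatewise convergence.\<close>

lemma tendsto_seq_seminorm_truncate:
  assumes "seq_seminorm q" "\<And>j. j \<le> N \<Longrightarrow> ((\<lambda>p. f p j) \<longlongrightarrow> l j) F"
  shows "((\<lambda>p. q (truncate N (f p))) \<longlongrightarrow> q (truncate N l)) F"
proof -
  have "((\<lambda>p. \<Sum>i\<le>N. \<bar>f p i - l i\<bar> * q (unit_seq i)) \<longlongrightarrow> (\<Sum>i\<le>N. \<bar>l i - l i\<bar> * q (unit_seq i))) F"
    by (intro tendsto_intros assms(2)) simp
  then have "((\<lambda>p. \<Sum>i\<le>N. \<bar>f p i - l i\<bar> * q (unit_seq i)) \<longlongrightarrow> 0) F" by simp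
  then have "((\<lambda>p. q (truncate N (f p)) - q (truncate N l)) \<longlongrightarrow> 0) F"
    by (rule Lim_null_comparison[rotated])
      (simp add: seq_seminorm_truncate_dist[OF assms(1)])
  then show ?thesis using Lim_null by blast
qed

lemma continuous_on_seq_seminorm_truncate:
  fixes f :: "real \<Rightarrow> nat \<Rightarrow> real"
  assumes "seq_seminorm q" "\<And>j. j \<le> N \<Longrightarrow> continuous_on S (\<lambda>t. f t j)"
  shows "continuous_on S (\<lambda>t. q (truncate N (f t)))"
  using assms by (auto simp: continuous_on_def intro!: tendsto_seq_seminorm_truncate)

section \<open>Integration over the torus\<close>

lemma emeasure_torus: "emeasure lborel {0..<2 * pi} = ennreal (2 * pi)"
  by simp

lemma torus_haar_density:
  "torus_haar = density lborel (\<lambda>x. ennreal (indicator {0..<2 * pi} x / (2 * pi)))"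
  unfolding torus_haar_def uniform_measure_def emeasure_torus
  by (intro density_cong) (auto simp: divide_ennreal[symmetric] ennreal_indicator split: split_indicator)

lemma set_integrable_torus:
  fixes f :: "real \<Rightarrow> real"
  assumes "continuous_on UNIV f"
  shows "set_integrable lborel {0..<2 * pi} f"
proof -
  have "continuous_on {0..2 * pi} f"
    using assms by (rule continuous_on_subset) simp
  then have "set_integrable lborel {0..2 * pi} f"
    by (rule borel_integrable_atLeastAtMost')
  then show ?thesis
    by (rule set_integrable_subset) auto
qed

lemma torus_integrable:
  fixes f :: "real \<Rightarrow> real"
  assumes "continuous_on UNIV f"
  shows "integrable torus_haar f"
proof -
  have [measurable]: "f \<in> borel_measurable borel"
    using assms by (rule borel_measurable_continuous_onI)
  have "integrable lborel (\<lambda>x. (indicator {0..<2 * pi} x *\<^sub>R f x) / (2 * pi))"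
    using set_integrable_torus[OF assms] unfolding set_integrable_def
    by (intro integrable_divide_zero)
  then show ?thesis
    unfolding torus_haar_density
    by (subst integrable_density) (auto simp: field_simps)
qed

lemma torus_integral:
  fixes f :: "real \<Rightarrow> real"
  assumes "continuous_on UNIV f"
  shows "(\<integral>t. f t \<partial>torus_haar) = integral {0..2 * pi} f / (2 * pi)"
proof -
  have [measurable]: "f \<in> borel_measurable borel"
    using assms by (rule borel_measurable_continuous_onI)
  have "(\<integral>t. f t \<partial>torus_haar) = (\<integral>x. (indicator {0..<2 * pi} x *\<^sub>R f x) / (2 * pi) \<partial>lborel)"
    unfolding torus_haar_density by (subst integral_density) (auto simp: field_simps)
  also have "\<dots> = integral {0..<2 * pi} f / (2 * pi)"
    using set_borel_integral_eq_integral(2)[OF set_integrable_torus[OF assms]]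
    by (simp add: set_lebesgue_integral_def)
  also have "integral {0..<2 * pi} f = integral {0..2 * pi} f"
    by (rule integral_subset_negligible) (auto intro!: negligible_subset[of "{2*pi}"])
  finally show ?thesis .
qed

lemma torus_integral_const: "(\<integral>t. c \<partial>torus_haar) = (c :: real)"
  using torus_integral[of "\<lambda>_. c"] by (simp del: lebesgue_integral_const)

lemma torus_integral_cos:
  assumes "L > 0"
  shows "(\<integral>t. cos (real L * t) \<partial>torus_haar) = 0"
proof -
  have "((\<lambda>t. cos (real L * t)) has_integral
      sin (real L * (2 * pi)) / real L - sin (real L * 0) / real L) {0..2 * pi}"
    using assms
    by (intro fundamental_theorem_of_calculus)
      (auto intro!: derivative_eq_intros simp flip: has_real_derivative_iff_has_vector_derivative)
  moreover have "sin (real L * (2 * pi)) = 0"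
    using sin_npi[of "2 * L"] by (simp add: mult_ac)
  ultimately have "integral {0..2 * pi} (\<lambda>t. cos (real L * t)) = 0"
    by (simp add: integral_unique)
  then show ?thesis
    by (subst torus_integral) (auto intro!: continuous_intros)
qed

text \<open>Jensen's inequality. The seminorm of a Riemann sum is at most the Riemann sum of the seminorms;
  both sides converge along the filter of tagged divisions, the left one because only finitely many
  coordinates are involved.\<close>

lemma seminorm_torus_integral_le:
  assumes q: "seq_seminorm q"
    and f: "\<And>j. j \<le> N \<Longrightarrow> continuous_on UNIV (\<lambda>t. f t j)"
  shows "q (truncate N (\<lambda>j. \<integral>t. f t j \<partial>torus_haar)) \<le> (\<integral>t. q (truncate N (f t)) \<partial>torus_haar)"
proof -
  let ?I = "cbox 0 (2 * pi) :: real set"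
  let ?S = "\<lambda>(g :: real \<Rightarrow> real) p. \<Sum>(x, k :: real set)\<in>p. measure lborel k *\<^sub>R g x"
  have qf: "continuous_on UNIV (\<lambda>t. q (truncate N (f t)))"
    by (rule continuous_on_seq_seminorm_truncate[OF q f])
  have lim: "(?S g \<longlongrightarrow> integral {0..2 * pi} g) (division_filter ?I)"
    if "continuous_on UNIV g" for g
  proof -
    have "g integrable_on ?I"
      using that by (intro integrable_continuous) (rule continuous_on_subset, auto)
    then show ?thesis
      using has_integral_cbox[THEN iffD1, OF integrable_integral, of g 0 "2 * pi"]
      by (simp only: box_real)
  qed
  have le: "\<forall>\<^sub>F p in division_filter ?I.
      q (truncate N (\<lambda>j. ?S (\<lambda>t. f t j) p)) \<le> ?S (\<lambda>t. q (truncate N (f t))) p"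
    using eventually_division_filter_tagged_division
  proof (rule eventually_mono)
    fix p assume "p tagged_division_of ?I"
    then have fin: "finite p" by (rule tagged_division_of_finite)
    have "truncate N (\<lambda>j. ?S (\<lambda>t. f t j) p)
        = (\<lambda>j. \<Sum>xk\<in>p. measure lborel (snd xk) * truncate N (f (fst xk)) j)"
      by (auto simp: fun_eq_iff split_beta)
    then have "q (truncate N (\<lambda>j. ?S (\<lambda>t. f t j) p))
        \<le> (\<Sum>xk\<in>p. q (\<lambda>j. measure lborel (snd xk) * truncate N (f (fst xk)) j))"
      by (simp only: seq_seminorm_sum[OF q fin])
    also have "\<dots> = ?S (\<lambda>t. q (truncate N (f t))) p"
      by (simp add: seq_seminorm_scale[OF q] split_beta)
    finally show "q (truncate N (\<lambda>j. ?S (\<lambda>t. f t j) p)) \<le> ?S (\<lambda>t. q (truncate N (f t))) p" .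
  qed
  have "((\<lambda>p. q (truncate N (\<lambda>j. ?S (\<lambda>t. f t j) p)))
      \<longlongrightarrow> q (truncate N (\<lambda>j. integral {0..2 * pi} (\<lambda>t. f t j)))) (division_filter ?I)"
    by (rule tendsto_seq_seminorm_truncate[OF q lim[OF f]])
  from tendsto_le[OF division_filter_not_empty lim[OF qf] this le]
  have "q (truncate N (\<lambda>j. integral {0..2 * pi} (\<lambda>t. f t j)))
      \<le> integral {0..2 * pi} (\<lambda>t. q (truncate N (f t)))" .
  moreover have "q (truncate N (\<lambda>j. \<integral>t. f t j \<partial>torus_haar))
      = q (truncate N (\<lambda>j. integral {0..2 * pi} (\<lambda>t. f t j))) / (2 * pi)"
  proof -
    have "truncate N (\<lambda>j. \<integral>t. f t j \<partial>torus_haar)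
        = (\<lambda>j. (1 / (2 * pi)) * truncate N (\<lambda>j. integral {0..2 * pi} (\<lambda>t. f t j)) j)"
      by (auto simp: fun_eq_iff torus_integral f)
    then show ?thesis
      by (simp only: seq_seminorm_scale[OF q]) simp
  qed
  ultimately show ?thesis
    by (simp add: torus_integral[OF qf] divide_right_mono)
qed

section \<open>Riesz products of lacunary cosines\<close>

text \<open>The factor at \<open>k\<close> shifts frequencies by at most \<open>2 n\<^sub>k\<close>, so the product has no frequency beyond
  \<open>2 (n\<^sub>1 + \<dots> + n\<^sub>N)\<close> and is orthogonal to every higher cosine.\<close>

lemma cosine_product_orthogonal:
  fixes n :: "nat \<Rightarrow> nat" and a b c :: "nat \<Rightarrow> real"
  assumes "L > 2 * (\<Sum>k=1..N. n k)"
  shows "(\<integral>t. (\<Prod>k=1..N. a k + b k * cos (real (n k) * t) + c k * cos (real (2 * n k) * t))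
     * cos (real L * t) \<partial>torus_haar) = 0"
  using assms
proof (induction N arbitrary: L)
  case 0
  then show ?case using torus_integral_cos[of L] by simp
next
  case (Suc N)
  let ?P = "\<lambda>t. \<Prod>k=1..N. a k + b k * cos (real (n k) * t) + c k * cos (real (2 * n k) * t)"
  let ?m = "n (Suc N)"
  (* Multiplication by the last factor moves the frequency L to one of M, ..., M + 4 n(N+1). *)
  define M where "M = L - 2 * ?m"
  have M: "M > 2 * (\<Sum>k=1..N. n k)" and L: "L = M + 2 * ?m"
    using Suc.prems by (auto simp: M_def)
  have z: "(\<integral>t. ?P t * cos (real (M + d) * t) \<partial>torus_haar) = 0" for d
    using M by (intro Suc.IH) simp
  have int: "integrable torus_haar (\<lambda>t. ?P t * cos (real K * t))" for K
    by (intro torus_integrable continuous_intros)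
  have regroup: "Q * v = x * (p * v) + b' / 2 * (p * u1 + p * u3) + c' / 2 * (p * u0 + p * u4)"
    if "u * v = (u1 + u3) / 2" "w * v = (u0 + u4) / 2" "Q = p * (x + b' * u + c' * w)"
    for Q p x b' c' u v w u0 u1 u3 u4 :: real
  proof -
    have "Q * v = x * (p * v) + b' * p * (u * v) + c' * p * (w * v)"
      unfolding that(3) by (simp add: algebra_simps)
    then show ?thesis
      unfolding that(1,2) by (simp add: algebra_simps add_divide_distrib)
  qed
  have expand: "(\<Prod>k=1..Suc N. a k + b k * cos (real (n k) * t) + c k * cos (real (2 * n k) * t))
       * cos (real L * t)
     = a (Suc N) * (?P t * cos (real (M + 2 * ?m) * t))
     + b (Suc N) / 2 * (?P t * cos (real (M + ?m) * t) + ?P t * cos (real (M + 3 * ?m) * t))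
     + c (Suc N) / 2 * (?P t * cos (real (M + 0) * t) + ?P t * cos (real (M + 4 * ?m) * t))" for t
  proof -
    have "cos (real ?m * t) * cos (real L * t)
        = (cos (real (M + ?m) * t) + cos (real (M + 3 * ?m) * t)) / 2"
      using cos_times_cos[of "real L * t" "real ?m * t"] by (simp add: L algebra_simps)
    moreover have "cos (real (2 * ?m) * t) * cos (real L * t)
        = (cos (real (M + 0) * t) + cos (real (M + 4 * ?m) * t)) / 2"
      using cos_times_cos[of "real L * t" "real (2 * ?m) * t"] by (simp add: L algebra_simps)
    moreover have "(\<Prod>k=1..Suc N. a k + b k * cos (real (n k) * t) + c k * cos (real (2 * n k) * t))
        = ?P t * (a (Suc N) + b (Suc N) * cos (real ?m * t) + c (Suc N) * cos (real (2 * ?m) * t))"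
      by simp
    ultimately show ?thesis
      unfolding L[symmetric] by (rule regroup)
  qed
  have combine: "(\<integral>t. x * f t + y * (f1 t + f3 t) + w * (f0 t + f4 t) \<partial>torus_haar) = 0"
    if "integrable torus_haar f" "integrable torus_haar f1" "integrable torus_haar f3"
      "integrable torus_haar f0" "integrable torus_haar f4"
      "integral\<^sup>L torus_haar f = 0" "integral\<^sup>L torus_haar f1 = 0" "integral\<^sup>L torus_haar f3 = 0"
      "integral\<^sup>L torus_haar f0 = 0" "integral\<^sup>L torus_haar f4 = 0"
    for x y w :: real and f f0 f1 f3 f4 :: "real \<Rightarrow> real"
    using that by simp
  show ?case
    unfolding expand by (intro combine int z)
qed

text \<open>Expanding the last factor leaves its constant term times the previous product, plus terms of
  frequency at least \<open>n\<^sub>N\<close>, which is beyond the spectrum of the previous product. The mean is thus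
  the same as for independent uniform phases.\<close>

lemma cosine_product_mean:
  fixes n :: "nat \<Rightarrow> nat" and a b c :: "nat \<Rightarrow> real"
  assumes "\<And>k. 1 \<le> k \<Longrightarrow> k \<le> N \<Longrightarrow> n k > 2 * (\<Sum>l=1..<k. n l)"
  shows "(\<integral>t. (\<Prod>k=1..N. a k + b k * cos (real (n k) * t) + c k * cos (real (2 * n k) * t)) \<partial>torus_haar)
    = (\<Prod>k=1..N. a k)"
  using assms
proof (induction N)
  case 0
  then show ?case using torus_integral_const[of 1] by (simp del: lebesgue_integral_const)
next
  case (Suc N)
  let ?P = "\<lambda>t. \<Prod>k=1..N. a k + b k * cos (real (n k) * t) + c k * cos (real (2 * n k) * t)"
  let ?m = "n (Suc N)"
  have m: "?m > 2 * (\<Sum>l=1..N. n l)"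
    using Suc.prems[of "Suc N"] by (simp add: atLeastLessThanSuc_atLeastAtMost)
  have z: "(\<integral>t. ?P t * cos (real K * t) \<partial>torus_haar) = 0" if "K \<ge> ?m" for K
    using m that by (intro cosine_product_orthogonal) simp
  have z2: "(\<integral>t. ?P t * cos (real (2 * ?m) * t) \<partial>torus_haar) = 0"
    by (rule z) simp
  have int: "integrable torus_haar (\<lambda>t. ?P t * cos (real K * t))" "integrable torus_haar ?P" for K
    by (intro torus_integrable continuous_intros)+
  have expand: "(\<Prod>k=1..Suc N. a k + b k * cos (real (n k) * t) + c k * cos (real (2 * n k) * t))
     = a (Suc N) * ?P t + b (Suc N) * (?P t * cos (real ?m * t))
      + c (Suc N) * (?P t * cos (real (2 * ?m) * t))" for t
    by (simp add: algebra_simps)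
  have combine: "(\<integral>t. x * f t + y * f1 t + w * f2 t \<partial>torus_haar) = x * integral\<^sup>L torus_haar f"
    if "integrable torus_haar f" "integrable torus_haar f1" "integrable torus_haar f2"
      "integral\<^sup>L torus_haar f1 = 0" "integral\<^sup>L torus_haar f2 = 0"
    for x y w :: real and f f1 f2 :: "real \<Rightarrow> real"
    using that by simp
  have "(\<integral>t. (\<Prod>k=1..Suc N. a k + b k * cos (real (n k) * t) + c k * cos (real (2 * n k) * t)) \<partial>torus_haar)
     = a (Suc N) * (\<integral>t. ?P t \<partial>torus_haar)"
    unfolding expand by (intro combine int z z2 order_refl)
  also have "(\<integral>t. ?P t \<partial>torus_haar) = (\<Prod>k=1..N. a k)"
    using Suc.prems by (intro Suc.IH) auto
  finally show ?case by simp
qed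

lemma lacunary3_dominates:
  assumes "lacunary3 n" "k \<ge> 1"
  shows "n k > 2 * (\<Sum>l=1..<k. n l)"
  using assms(2)
proof (induction k rule: nat_induct_at_least)
  case base
  then show ?case using assms(1) by (auto simp: lacunary3_def)
next
  case (Suc k)
  have "n k > 0" "real (n (Suc k)) / real (n k) \<ge> 3"
    using assms(1) Suc.hyps by (auto simp: lacunary3_def)
  then have "real (n (Suc k)) \<ge> real (3 * n k)"
    by (simp add: field_simps)
  then have "n (Suc k) \<ge> 3 * n k" by (simp only: of_nat_le_iff)
  then show ?case using Suc.IH Suc.hyps by simp
qed

section \<open>Fair coins with values one half and three halves\<close>

text \<open>The values are chosen with mean one, so that partial products of coins play the role of the
  Riesz products. Coins are numbered from zero.\<close>

definition coins :: "nat \<Rightarrow> (nat \<Rightarrow> real) set" where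
  "coins m = PiE {..<m} (\<lambda>_. {1/2, 3/2})"

definition coin_avg :: "nat \<Rightarrow> ((nat \<Rightarrow> real) \<Rightarrow> real) \<Rightarrow> real" where
  "coin_avg m f = (\<Sum>y\<in>coins m. f y) / 2 ^ m"

definition prefix_prod :: "(nat \<Rightarrow> real) \<Rightarrow> nat \<Rightarrow> real" where
  "prefix_prod y k = (\<Prod>l<k. y l)"

lemma coins_value: "y \<in> coins m \<Longrightarrow> l < m \<Longrightarrow> y l = 1/2 \<or> y l = 3/2"
  unfolding coins_def by (auto simp: PiE_def Pi_def)

lemma coins_pos: "y \<in> coins m \<Longrightarrow> l < m \<Longrightarrow> y l > 0"
  using coins_value by fastforce

lemma coin_avg_cong: "(\<And>y. y \<in> coins m \<Longrightarrow> f y = g y) \<Longrightarrow> coin_avg m f = coin_avg m g"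
  unfolding coin_avg_def by (simp cong: sum.cong)

lemma coin_avg_mono: "(\<And>y. y \<in> coins m \<Longrightarrow> f y \<le> g y) \<Longrightarrow> coin_avg m f \<le> coin_avg m g"
  unfolding coin_avg_def by (intro divide_right_mono sum_mono) auto

lemma coin_avg_add: "coin_avg m (\<lambda>y. f y + g y) = coin_avg m f + coin_avg m g"
  unfolding coin_avg_def by (simp add: sum.distrib add_divide_distrib)

lemma coin_avg_diff: "coin_avg m (\<lambda>y. f y - g y) = coin_avg m f - coin_avg m g"
  unfolding coin_avg_def by (simp add: sum_subtractf diff_divide_distrib)

lemma coin_avg_mult_left: "coin_avg m (\<lambda>y. c * f y) = c * coin_avg m f"
  unfolding coin_avg_def by (simp add: sum_distrib_left)

lemma coin_avg_mult_right: "coin_avg m (\<lambda>y. f y * c) = coin_avg m f * c"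
  unfolding coin_avg_def by (simp add: sum_distrib_right)

lemma coin_avg_sum: "coin_avg m (\<lambda>y. \<Sum>i\<in>A. f i y) = (\<Sum>i\<in>A. coin_avg m (f i))"
  unfolding coin_avg_def by (subst sum.swap) (simp add: sum_divide_distrib)

lemma coin_avg_prod:
  "coin_avg m (\<lambda>y. \<Prod>l<m. f l (y l)) = (\<Prod>l<m. (f l (1/2) + f l (3/2)) / 2)"
proof -
  have "(\<Prod>l<m. \<Sum>x\<in>{1/2, 3/2}. f l x) = (\<Sum>y\<in>coins m. \<Prod>l<m. f l (y l))"
    unfolding coins_def by (intro prod_sum_PiE) auto
  then show ?thesis
    unfolding coin_avg_def by (simp add: prod_dividef)
qed

lemma prefix_prod_pos: "y \<in> coins m \<Longrightarrow> k \<le> m \<Longrightarrow> prefix_prod y k > 0"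
  unfolding prefix_prod_def by (intro prod_pos) (auto intro: coins_pos)

lemma prod_lessThan_extend:
  fixes g :: "nat \<Rightarrow> real"
  shows "k \<le> m \<Longrightarrow> (\<Prod>l<k. g l) = (\<Prod>l<m. if l < k then g l else 1)"
  by (rule prod.mono_neutral_cong_left) auto

text \<open>Independence of the first coins, of coin \<open>i\<close> and of coin \<open>i + 1\<close>, and mean one of each coin.\<close>

lemma coin_avg_prefix_prod_two:
  assumes "Suc i < m"
  shows "coin_avg m (\<lambda>y. prefix_prod y i * (g (y i) * h (y (Suc i))))
    = (g (1/2) + g (3/2)) / 2 * ((h (1/2) + h (3/2)) / 2)"
proof -
  define f :: "nat \<Rightarrow> real \<Rightarrow> real" where
    "f l = (if l < i then (\<lambda>x. x) else if l = i then g else if l = Suc i then h else (\<lambda>_. 1))" for l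
  have *: "(\<Prod>l<m. F l) = (\<Prod>l<i. F l) * (F i * F (Suc i))"
    if "\<And>l. l > Suc i \<Longrightarrow> F l = 1" for F :: "nat \<Rightarrow> real"
  proof -
    have "(\<Prod>l<m. F l) = (\<Prod>l<Suc (Suc i). F l)"
      using assms by (intro prod.mono_neutral_right) (auto intro!: that)
    then show ?thesis by simp
  qed
  have "coin_avg m (\<lambda>y. prefix_prod y i * (g (y i) * h (y (Suc i))))
      = coin_avg m (\<lambda>y. \<Prod>l<m. f l (y l))"
    by (subst *) (auto simp: f_def prefix_prod_def)
  also have "\<dots> = (\<Prod>l<m. (f l (1/2) + f l (3/2)) / 2)"
    by (rule coin_avg_prod)
  also have "\<dots> = (g (1/2) + g (3/2)) / 2 * ((h (1/2) + h (3/2)) / 2)"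
    by (subst *) (auto simp: f_def)
  finally show ?thesis .
qed

lemma coin_avg_prefix_prod_diff_sq:
  assumes "Suc i < m"
  shows "coin_avg m (\<lambda>y. prefix_prod y i * (y i - y (Suc i))\<^sup>2) = 1 / 2"
proof -
  have "(\<lambda>y. prefix_prod y i * (y i - y (Suc i))\<^sup>2)
      = (\<lambda>y. prefix_prod y i * ((y i)\<^sup>2 * 1) - 2 * (prefix_prod y i * (y i * y (Suc i)))
        + prefix_prod y i * (1 * (y (Suc i))\<^sup>2))"
    by (auto simp: fun_eq_iff power2_eq_square algebra_simps)
  then show ?thesis
    using coin_avg_prefix_prod_two[OF assms, of "\<lambda>x. x\<^sup>2" "\<lambda>_. 1"]
      coin_avg_prefix_prod_two[OF assms, of "\<lambda>x. x" "\<lambda>x. x"]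
      coin_avg_prefix_prod_two[OF assms, of "\<lambda>_. 1" "\<lambda>x. x\<^sup>2"]
    by (simp add: coin_avg_add coin_avg_diff coin_avg_mult_left power2_eq_square)
qed

text \<open>The mean of the square root of a coin equals \<open>cos (\<pi>/12)\<close>. That it is strictly less than \<open>1\<close> is
  the source of all decay below.\<close>

abbreviation sqrt_mean :: real where
  "sqrt_mean \<equiv> (sqrt (1/2) + sqrt (3/2)) / 2"

lemma sqrt_mean_le: "sqrt_mean \<le> 29 / 30"
proof -
  have "sqrt (1/2) \<le> 7072/10000"
    by (rule real_le_lsqrt) (simp_all add: power2_eq_square)
  moreover have "sqrt (3/2) \<le> 12248/10000"
    by (rule real_le_lsqrt) (simp_all add: power2_eq_square)
  ultimately
  show ?thesis by simp
qed

lemma sqrt_prod_lessThan: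
  fixes g :: "nat \<Rightarrow> real"
  shows "sqrt (\<Prod>l<m. g l) = (\<Prod>l<m. sqrt (g l))"
  by (induction m) (simp_all add: real_sqrt_mult)

text \<open>In \<open>sqrt (P\<^sub>i P\<^sub>k)\<close> the coins common to both products appear to the first power and have mean
  one; each of the \<open>\<bar>i - k\<bar>\<close> others appears as a square root.\<close>

lemma coin_avg_sqrt_prefix_prod_ordered:
  assumes "k \<le> i" "i \<le> m"
  shows "coin_avg m (\<lambda>y. sqrt (prefix_prod y k * prefix_prod y i)) = sqrt_mean ^ (i - k)"
proof -
  define f :: "nat \<Rightarrow> real \<Rightarrow> real" where
    "f l x = (if l < k then x else if l < i then sqrt x else 1)" for l x
  have "coin_avg m (\<lambda>y. sqrt (prefix_prod y k * prefix_prod y i)) = coin_avg m (\<lambda>y. \<Prod>l<m. f l (y l))"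
  proof (rule coin_avg_cong)
    fix y assume y: "y \<in> coins m"
    have "prefix_prod y k * prefix_prod y i
        = (\<Prod>l<m. (if l < k then y l else 1) * (if l < i then y l else 1))"
      unfolding prefix_prod_def prod.distrib
      using prod_lessThan_extend[of k m y] prod_lessThan_extend[of i m y] assms by simp
    also have "sqrt \<dots> = (\<Prod>l<m. f l (y l))"
      unfolding sqrt_prod_lessThan
      using assms(1) coins_pos[OF y, THEN less_imp_le]
      by (intro prod.cong refl) (simp add: f_def)
    finally show "sqrt (prefix_prod y k * prefix_prod y i) = (\<Prod>l<m. f l (y l))" .
  qed
  also have "\<dots> = (\<Prod>l<m. (f l (1/2) + f l (3/2)) / 2)"
    by (rule coin_avg_prod)
  also have "\<dots> = (\<Prod>l\<in>{k..<i}. sqrt_mean)"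
    using assms by (intro prod.mono_neutral_cong_right) (auto simp: f_def)
  finally show ?thesis by simp
qed

lemma coin_avg_sqrt_prefix_prod:
  assumes "k \<le> m" "i \<le> m"
  shows "coin_avg m (\<lambda>y. sqrt (prefix_prod y i * prefix_prod y k))
    = (if k \<le> i then sqrt_mean ^ (i - k) else sqrt_mean ^ (k - i))"
proof (cases "k \<le> i")
  case True
  then show ?thesis
    using coin_avg_sqrt_prefix_prod_ordered[OF True assms(2)]
    by (simp only: mult.commute[of "prefix_prod _ i"] if_True)
next
  case False
  then show ?thesis
    using coin_avg_sqrt_prefix_prod_ordered[of i k m] assms(1) by (simp only: if_False)
qed

section \<open>Swapping two neighbouring coins\<close>

definition swap_at :: "nat \<Rightarrow> (nat \<Rightarrow> real) \<Rightarrow> nat \<Rightarrow> real" where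
  "swap_at i y = y(i := y (Suc i), Suc i := y i)"

lemma swap_at_swap_at: "swap_at i (swap_at i y) = y"
  by (auto simp: swap_at_def fun_eq_iff)

lemma swap_at_coins: "y \<in> coins m \<Longrightarrow> Suc i < m \<Longrightarrow> swap_at i y \<in> coins m"
  unfolding coins_def swap_at_def PiE_iff extensional_def by auto

lemma coin_avg_swap:
  assumes "Suc i < m"
  shows "coin_avg m (\<lambda>y. f (swap_at i y)) = coin_avg m f"
proof -
  have "(\<Sum>y\<in>coins m. f (swap_at i y)) = (\<Sum>y\<in>coins m. f y)"
    by (rule sum.reindex_bij_witness[of _ "swap_at i" "swap_at i"])
      (auto simp: swap_at_swap_at swap_at_coins assms)
  then show ?thesis by (simp add: coin_avg_def)
qed

lemma prefix_prod_swap_same: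
  assumes "k \<noteq> Suc i"
  shows "prefix_prod (swap_at i y) k = prefix_prod y k"
proof (cases "k \<le> i")
  case True
  then show ?thesis
    unfolding prefix_prod_def by (intro prod.cong) (auto simp: swap_at_def)
next
  case False
  then have "Suc (Suc i) \<le> k" using assms by simp
  then show ?thesis
  proof (induction k rule: dec_induct)
    case base
    have "(\<Prod>l<i. swap_at i y l) = (\<Prod>l<i. y l)"
      by (intro prod.cong) (auto simp: swap_at_def)
    then show ?case by (simp add: prefix_prod_def) (simp add: swap_at_def)
  next
    case (step k)
    then show ?case by (simp add: prefix_prod_def) (simp add: swap_at_def)
  qed
qed

lemma prefix_prod_Suc: "prefix_prod y (Suc k) = prefix_prod y k * y k"
  by (simp add: prefix_prod_def)

lemma prefix_prod_swap_Suc: "prefix_prod (swap_at i y) (Suc i) = prefix_prod y i * y (Suc i)"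
  using prefix_prod_swap_same[of i i y] by (simp add: prefix_prod_Suc) (simp add: swap_at_def)

abbreviation prefix_total :: "nat \<Rightarrow> (nat \<Rightarrow> real) \<Rightarrow> real" where
  "prefix_total m y \<equiv> (\<Sum>k<m. prefix_prod y k)"

lemma prefix_total_pos: "y \<in> coins m \<Longrightarrow> m > 0 \<Longrightarrow> prefix_total m y > 0"
  by (intro sum_pos) (auto intro: prefix_prod_pos)

text \<open>Only one summand changes under the exchange, and the ratio of two coins is at most three.\<close>

lemma prefix_total_swap:
  assumes "y \<in> coins m" "Suc i < m"
  shows "prefix_total m y \<le> 3 * prefix_total m (swap_at i y)"
  unfolding sum_distrib_left
proof (rule sum_mono)
  fix k assume "k \<in> {..<m}"
  then have pos: "prefix_prod y k > 0" "prefix_prod y i > 0"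
    using assms by (auto intro: prefix_prod_pos)
  have "y i \<le> 3 * y (Suc i)"
    using coins_value[OF assms(1), of i] coins_value[OF assms(1), of "Suc i"] assms(2) by auto
  then show "prefix_prod y k \<le> 3 * prefix_prod (swap_at i y) k"
    using pos mult_left_mono[of "y i" "3 * y (Suc i)" "prefix_prod y i"]
    by (cases "k = Suc i")
      (auto simp: prefix_prod_swap_same prefix_prod_swap_Suc prefix_prod_Suc[of y])
qed

section \<open>The inequality for coins\<close>

text \<open>With \<open>s = sqrt (z / a)\<close> this is the bound of the convex function \<open>s \<mapsto> 1 / s\<^sup>2\<close> by its tangent at
  \<open>s = B\<close>. It trades a quotient for quantities whose averages over coins are explicit.\<close>

lemma inverse_square_tangent:
  fixes a z B :: real
  assumes "a > 0" "z > 0" "B > 0"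
  shows "a\<^sup>2 / z \<ge> 3 * a / B\<^sup>2 - 2 * sqrt (a * z) / B ^ 3"
proof -
  define r s where "r = sqrt a" and "s = sqrt z"
  have pos: "r > 0" "s > 0" and sq: "a = r\<^sup>2" "z = s\<^sup>2" "sqrt (a * z) = r * s"
    using assms by (auto simp: r_def s_def real_sqrt_mult)
  have "0 \<le> (s - r * B)\<^sup>2 * (2 * s + r * B)"
    using pos assms by simp
  also have "\<dots> = 2 * s ^ 3 + (r * B) ^ 3 - 3 * (s\<^sup>2 * (r * B))"
    by (simp add: algebra_simps power2_eq_square power3_eq_cube)
  finally have "0 \<le> r * (2 * s ^ 3 + (r * B) ^ 3 - 3 * (s\<^sup>2 * (r * B))) / (s\<^sup>2 * B ^ 3)"
    using pos assms by simp
  also have "\<dots> = r * (2 * s ^ 3) / (s\<^sup>2 * B ^ 3) + r * (r * B) ^ 3 / (s\<^sup>2 * B ^ 3)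
      - r * (3 * (s\<^sup>2 * (r * B))) / (s\<^sup>2 * B ^ 3)"
    by (simp add: distrib_left right_diff_distrib add_divide_distrib diff_divide_distrib)
  also have "r * (2 * s ^ 3) / (s\<^sup>2 * B ^ 3) = 2 * (r * s) / B ^ 3"
    using pos by (simp add: power2_eq_square power3_eq_cube mult.assoc)
  also have "r * (r * B) ^ 3 / (s\<^sup>2 * B ^ 3) = (r\<^sup>2)\<^sup>2 / s\<^sup>2"
    using assms(3) by (simp add: power2_eq_square power3_eq_cube)
  also have "r * (3 * (s\<^sup>2 * (r * B))) / (s\<^sup>2 * B ^ 3) = 3 * r\<^sup>2 / B\<^sup>2"
    using pos assms(3) by (simp add: power2_eq_square power3_eq_cube)
  finally show ?thesis unfolding sq(3) unfolding sq(1,2) by simp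
qed

lemma sum_geometric_two_sided:
  fixes x :: real
  assumes "0 \<le> x" "x < 1" "i < m"
  shows "(\<Sum>k<m. if k \<le> i then x ^ (i - k) else x ^ (k - i)) \<le> 2 / (1 - x)"
proof -
  have geo: "(\<Sum>k<n. x ^ k) \<le> 1 / (1 - x)" for n
    using assms by (simp add: sum_gp_strict divide_right_mono)
  let ?g = "\<lambda>k. if k \<le> i then x ^ (i - k) else x ^ (k - i)"
  have "(\<Sum>k<m. ?g k) = (\<Sum>k\<in>{..<Suc i}. ?g k) + (\<Sum>k\<in>{Suc i..<m}. ?g k)"
    using assms by (subst sum.union_disjoint[symmetric]) (auto intro!: sum.cong)
  also have "(\<Sum>k\<in>{..<Suc i}. ?g k) = (\<Sum>k<Suc i. x ^ k)"
    by (rule sum.reindex_bij_witness[of _ "\<lambda>k. i - k" "\<lambda>k. i - k"]) auto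
  also have "(\<Sum>k\<in>{Suc i..<m}. ?g k) \<le> (\<Sum>k<m. x ^ k)"
  proof -
    have "(\<Sum>k\<in>{Suc i..<m}. ?g k) = (\<Sum>k\<in>{1..<m - i}. x ^ k)"
      by (rule sum.reindex_bij_witness[of _ "\<lambda>k. k + i" "\<lambda>k. k - i"]) auto
    also have "\<dots> \<le> (\<Sum>k<m. x ^ k)"
      using assms by (intro sum_mono2) auto
    finally show ?thesis .
  qed
  finally show ?thesis using geo[of "Suc i"] geo[of m] by simp
qed

lemma sqrt_sum_le:
  fixes g :: "nat \<Rightarrow> real"
  assumes "\<And>k. k < m \<Longrightarrow> g k \<ge> 0"
  shows "sqrt (\<Sum>k<m. g k) \<le> (\<Sum>k<m. sqrt (g k))"
  using assms
proof (induction m)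
  case (Suc m)
  have "sqrt ((\<Sum>k<m. g k) + g m) \<le> sqrt (\<Sum>k<m. g k) + sqrt (g m)"
    using Suc.prems by (intro sqrt_add_le_add_sqrt sum_nonneg) auto
  moreover have "sqrt (\<Sum>k<m. g k) \<le> (\<Sum>k<m. sqrt (g k))"
    using Suc by simp
  ultimately show ?case by simp
qed simp

lemma coins_diff_values:
  assumes "y \<in> coins m" "i < m" "j < m"
  shows "y i - y j \<in> {-1, 0, 1}"
  using coins_value[OF assms(1,2)] coins_value[OF assms(1,3)] by (elim disjE) simp_all

text \<open>The tangent bound with \<open>a = P\<^sub>i\<close> and \<open>z = \<Sum>\<^sub>k P\<^sub>k\<close>, followed by \<open>sqrt z \<le> \<Sum>\<^sub>k sqrt P\<^sub>k\<close>, reduces the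
  claim to the averages of \<open>P\<^sub>i (y\<^sub>i - y\<^sub>i\<^sub>+\<^sub>1)\<^sup>2\<close>, which is \<open>1/2\<close>, and of \<open>sqrt (P\<^sub>i P\<^sub>k)\<close>, whose sum over
  \<open>k\<close> is at most \<open>2 / (1 - 29/30) = 60\<close>. The tangent point \<open>B = 120\<close> maximises the resulting
  \<open>3 / (2 B\<^sup>2) - 120 / B\<^sup>3\<close>.\<close>

lemma coin_avg_swap_gain:
  assumes "Suc i < m"
  shows "coin_avg m (\<lambda>y. (prefix_prod y i)\<^sup>2 * (y i - y (Suc i))\<^sup>2 / prefix_total m y) \<ge> 1 / 28800"
proof -
  have D: "(y i - y (Suc i))\<^sup>2 \<le> 1" if "y \<in> coins m" for y
    using coins_diff_values[OF that, of i "Suc i"] assms by auto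
  have pt: "3 / 120\<^sup>2 * (prefix_prod y i * (y i - y (Suc i))\<^sup>2)
      - 2 / 120 ^ 3 * (\<Sum>k<m. sqrt (prefix_prod y i * prefix_prod y k))
    \<le> (prefix_prod y i)\<^sup>2 * (y i - y (Suc i))\<^sup>2 / prefix_total m y" if y: "y \<in> coins m" for y
  proof -
    let ?a = "prefix_prod y i" and ?Z = "prefix_total m y" and ?D = "(y i - y (Suc i))\<^sup>2"
    have a: "?a > 0" and Z: "?Z > 0"
      using y assms by (auto intro: prefix_prod_pos prefix_total_pos)
    have "?D * sqrt (?a * ?Z) \<le> sqrt (?a * ?Z)"
      using D[OF y] a Z by (intro mult_left_le_one_le) auto
    also have "\<dots> \<le> (\<Sum>k<m. sqrt (?a * prefix_prod y k))"
      unfolding sum_distrib_left using a y assms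
      by (intro sqrt_sum_le) (auto intro!: mult_nonneg_nonneg less_imp_le[OF prefix_prod_pos])
    finally have s: "?D * sqrt (?a * ?Z) \<le> (\<Sum>k<m. sqrt (?a * prefix_prod y k))" .
    have "?D * (3 * ?a / 120\<^sup>2 - 2 * sqrt (?a * ?Z) / 120 ^ 3) \<le> ?D * (?a\<^sup>2 / ?Z)"
      using a Z by (intro mult_left_mono inverse_square_tangent) auto
    moreover have "?D * (3 * ?a / 120\<^sup>2 - 2 * sqrt (?a * ?Z) / 120 ^ 3)
        = 3 / 120\<^sup>2 * (?a * ?D) - 2 / 120 ^ 3 * (?D * sqrt (?a * ?Z))"
      by (simp add: right_diff_distrib)
    ultimately show ?thesis using s by (simp add: mult.commute)
  qed
  have "(\<Sum>k<m. coin_avg m (\<lambda>y. sqrt (prefix_prod y i * prefix_prod y k)))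
      = (\<Sum>k<m. if k \<le> i then sqrt_mean ^ (i - k) else sqrt_mean ^ (k - i))"
    using assms by (intro sum.cong refl coin_avg_sqrt_prefix_prod) auto
  also have "\<dots> \<le> 2 / (1 - sqrt_mean)"
    using sqrt_mean_le assms by (intro sum_geometric_two_sided) auto
  also have "\<dots> \<le> 2 / (1 / 30)"
    using sqrt_mean_le by (intro divide_left_mono) auto
  finally have S: "(\<Sum>k<m. coin_avg m (\<lambda>y. sqrt (prefix_prod y i * prefix_prod y k))) \<le> 60"
    by simp
  have "1 / 28800 \<le> 3 / 120\<^sup>2 * (1 / 2)
      - 2 / 120 ^ 3 * (\<Sum>k<m. coin_avg m (\<lambda>y. sqrt (prefix_prod y i * prefix_prod y k)))"
    using S by (simp add: power2_eq_square power3_eq_cube)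
  also have "\<dots> = coin_avg m (\<lambda>y. 3 / 120\<^sup>2 * (prefix_prod y i * (y i - y (Suc i))\<^sup>2)
      - 2 / 120 ^ 3 * (\<Sum>k<m. sqrt (prefix_prod y i * prefix_prod y k)))"
    unfolding coin_avg_diff coin_avg_mult_left coin_avg_sum coin_avg_prefix_prod_diff_sq[OF assms] ..
  also have "\<dots> \<le> coin_avg m (\<lambda>y. (prefix_prod y i)\<^sup>2 * (y i - y (Suc i))\<^sup>2 / prefix_total m y)"
    by (rule coin_avg_mono) (rule pt)
  finally show ?thesis .
qed

text \<open>The two sequences on the right differ in coordinate \<open>i\<close> only.\<close>

lemma seminorm_swap_le:
  assumes q: "seq_seminorm q" and "i \<le> N" and "prefix_prod y i \<ge> 0"
  shows "prefix_prod y i * \<bar>y i - y (Suc i)\<bar> * q (unit_seq i)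
    \<le> q (truncate N (\<lambda>j. prefix_prod y (Suc j)))
      + q (truncate N (\<lambda>j. prefix_prod (swap_at i y) (Suc j)))"
proof -
  have "truncate N (\<lambda>j. prefix_prod y (Suc j)) j - truncate N (\<lambda>j. prefix_prod (swap_at i y) (Suc j)) j
      = (prefix_prod y i * (y i - y (Suc i))) * unit_seq i j" for j
  proof (cases "j = i")
    case True
    then show ?thesis
      using assms by (simp add: prefix_prod_swap_Suc) (simp add: prefix_prod_Suc algebra_simps)
  next
    case False
    then show ?thesis by (simp add: prefix_prod_swap_same)
  qed
  then show ?thesis
    using seq_seminorm_diff[OF q, of "truncate N (\<lambda>j. prefix_prod y (Suc j))"
        "truncate N (\<lambda>j. prefix_prod (swap_at i y) (Suc j))"] assms(3)
    by (simp add: seq_seminorm_scale[OF q] abs_mult)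
qed

text \<open>The constant is \<open>1/28800\<close> from \<open>coin_avg_swap_gain\<close> divided by \<open>1 + 3\<close>, where the \<open>3\<close> is the price
  of moving the exchange of coins from the seminorm to the weight.\<close>

lemma coin_avg_seminorm_ge:
  assumes q: "seq_seminorm q"
  shows "(\<Sum>i\<le>N. q (unit_seq i)) / 115200
    \<le> coin_avg (N + 2) (\<lambda>y. q (truncate N (\<lambda>j. prefix_prod y (Suc j))))"
proof -
  define m where "m = N + 2"
  define F where "F y = q (truncate N (\<lambda>j. prefix_prod y (Suc j)))" for y
  define w where "w i y = prefix_prod y i / prefix_total m y" for i y
  have F: "F y \<ge> 0" for y
    unfolding F_def by (rule seq_seminorm_nonneg[OF q])
  have one: "1 / 28800 * q (unit_seq i) \<le> 4 * coin_avg m (\<lambda>y. w i y * F y)" if i: "i \<le> N" for i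
  proof -
    have im: "Suc i < m" using i by (simp add: m_def)
    have "1 / 28800 * q (unit_seq i)
        \<le> coin_avg m (\<lambda>y. (prefix_prod y i)\<^sup>2 * (y i - y (Suc i))\<^sup>2 / prefix_total m y) * q (unit_seq i)"
      by (intro mult_right_mono coin_avg_swap_gain im seq_seminorm_nonneg[OF q])
    also have "\<dots> = coin_avg m (\<lambda>y. (prefix_prod y i)\<^sup>2 * (y i - y (Suc i))\<^sup>2 / prefix_total m y * q (unit_seq i))"
      by (simp only: coin_avg_mult_right)
    also have "\<dots> \<le> coin_avg m (\<lambda>y. w i y * F y + w i y * F (swap_at i y))"
    proof (rule coin_avg_mono)
      fix y assume y: "y \<in> coins m"
      have a: "prefix_prod y i > 0" and Z: "prefix_total m y > 0"
        using y im by (auto intro: prefix_prod_pos prefix_total_pos)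
      have "(y i - y (Suc i))\<^sup>2 \<le> \<bar>y i - y (Suc i)\<bar>"
        using coins_diff_values[OF y, of i "Suc i"] im by auto
      then have "prefix_prod y i * (y i - y (Suc i))\<^sup>2 * q (unit_seq i)
          \<le> prefix_prod y i * \<bar>y i - y (Suc i)\<bar> * q (unit_seq i)"
        using a by (intro mult_right_mono mult_left_mono seq_seminorm_nonneg[OF q]) auto
      also have "\<dots> \<le> F y + F (swap_at i y)"
        using seminorm_swap_le[OF q i, of y] a unfolding F_def by simp
      finally have "w i y * (prefix_prod y i * (y i - y (Suc i))\<^sup>2 * q (unit_seq i))
          \<le> w i y * (F y + F (swap_at i y))"
        using a Z by (intro mult_left_mono) (auto simp: w_def)
      moreover have "(prefix_prod y i)\<^sup>2 * (y i - y (Suc i))\<^sup>2 / prefix_total m y * q (unit_seq i)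
          = w i y * (prefix_prod y i * (y i - y (Suc i))\<^sup>2 * q (unit_seq i))"
        by (simp add: w_def power2_eq_square[of "prefix_prod y i"])
      ultimately show "(prefix_prod y i)\<^sup>2 * (y i - y (Suc i))\<^sup>2 / prefix_total m y * q (unit_seq i)
          \<le> w i y * F y + w i y * F (swap_at i y)"
        by (simp only: distrib_left)
    qed
    (* The exchange preserves the average, so it may be moved from F to the weight. *)
    also have "\<dots> = coin_avg m (\<lambda>y. w i y * F y) + coin_avg m (\<lambda>y. w i (swap_at i y) * F y)"
      using coin_avg_swap[OF im, of "\<lambda>y. w i (swap_at i y) * F y"]
      by (simp add: coin_avg_add swap_at_swap_at)
    also have "coin_avg m (\<lambda>y. w i (swap_at i y) * F y) \<le> coin_avg m (\<lambda>y. 3 * (w i y * F y))"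
    proof (rule coin_avg_mono)
      fix y assume y: "y \<in> coins m"
      have a: "prefix_prod y i > 0" and Z: "prefix_total m y > 0" "prefix_total m (swap_at i y) > 0"
        using y im by (auto intro: prefix_prod_pos prefix_total_pos swap_at_coins)
      have "w i (swap_at i y) = prefix_prod y i / prefix_total m (swap_at i y)"
        by (simp add: w_def prefix_prod_swap_same)
      also have "\<dots> \<le> prefix_prod y i / (prefix_total m y / 3)"
        using a Z prefix_total_swap[OF y im] by (intro divide_left_mono) auto
      finally have "w i (swap_at i y) \<le> 3 * w i y"
        by (simp add: w_def mult.commute)
      then show "w i (swap_at i y) * F y \<le> 3 * (w i y * F y)"
        using mult_right_mono[OF _ F[of y]] by (simp add: mult.assoc[symmetric])
    qed
    finally show ?thesis by (simp add: coin_avg_mult_left)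
  qed
  have "(\<Sum>i\<le>N. q (unit_seq i)) / 115200 = (\<Sum>i\<le>N. 1 / 28800 * q (unit_seq i)) / 4"
    by (simp add: sum_divide_distrib)
  also have "\<dots> \<le> (\<Sum>i\<le>N. 4 * coin_avg m (\<lambda>y. w i y * F y)) / 4"
    by (intro divide_right_mono sum_mono one) auto
  also have "\<dots> = coin_avg m (\<lambda>y. (\<Sum>i\<le>N. w i y) * F y)"
    by (simp add: coin_avg_sum sum_distrib_right sum_divide_distrib)
  also have "\<dots> \<le> coin_avg m F"
  proof (rule coin_avg_mono)
    fix y assume y: "y \<in> coins m"
    have "(\<Sum>i\<le>N. prefix_prod y i) \<le> prefix_total m y"
      using y by (intro sum_mono2) (auto simp: m_def intro!: less_imp_le[OF prefix_prod_pos])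
    then have "(\<Sum>i\<le>N. w i y) \<le> 1"
      using prefix_total_pos[OF y] by (simp add: w_def sum_divide_distrib[symmetric] m_def)
    then show "(\<Sum>i\<le>N. w i y) * F y \<le> F y"
      using F mult_right_mono[of _ 1 "F y"] by simp
  qed
  finally show ?thesis by (simp add: F_def[abs_def] m_def)
qed

section \<open>From the torus to coins\<close>

text \<open>A Riesz product whose coefficients \<open>2 (y\<^sub>k - 1)\<close> are the signs \<open>\<plusminus>1\<close> of the coins, times the
  additional coin \<open>y\<^sub>0\<close>.\<close>

definition coin_kernel :: "(nat \<Rightarrow> nat) \<Rightarrow> nat \<Rightarrow> (nat \<Rightarrow> real) \<Rightarrow> real \<Rightarrow> real" where
  "coin_kernel n N y t = y 0 * (\<Prod>k=1..N. 1 + 2 * (y k - 1) * cos (real (n k) * t))"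

lemma continuous_on_coin_kernel: "continuous_on S (coin_kernel n N y)"
  unfolding coin_kernel_def by (intro continuous_intros)

lemma continuous_on_riesz_product: "continuous_on S (riesz_product n j)"
  unfolding riesz_product_def by (intro continuous_intros)

lemma coin_kernel_nonneg:
  assumes "y \<in> coins (N + 2)"
  shows "coin_kernel n N y t \<ge> 0"
  unfolding coin_kernel_def
proof (intro mult_nonneg_nonneg prod_nonneg)
  show "0 \<le> y 0" using coins_pos[OF assms, of 0] by simp
  fix k assume "k \<in> {1..N}"
  then have "\<bar>2 * (y k - 1)\<bar> = 1"
    using coins_value[OF assms, of k] by auto
  then have "\<bar>2 * (y k - 1) * cos (real (n k) * t)\<bar> \<le> 1"
    by (simp only: abs_mult[of "2 * (y k - 1)"] mult_1_left abs_cos_le_one)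
  then show "0 \<le> 1 + 2 * (y k - 1) * cos (real (n k) * t)"
    by linarith
qed

lemma prod_lessThan_Suc_head:
  fixes g :: "nat \<Rightarrow> real"
  shows "(\<Prod>l<Suc N. g l) = g 0 * (\<Prod>k=1..N. g k)"
  by (simp only: prod.lessThan_Suc_shift prod.atLeast1_atMost_eq One_nat_def)

lemma coin_avg_coin_kernel: "coin_avg (N + 2) (\<lambda>y. coin_kernel n N y t) = 1"
proof -
  define f :: "nat \<Rightarrow> real \<Rightarrow> real" where
    "f l x = (if l = 0 then x else if l \<le> N then 1 + 2 * (x - 1) * cos (real (n l) * t) else 1)" for l x
  have "coin_kernel n N y t = (\<Prod>l<N + 2. f l (y l))" for y
  proof -
    have "(\<Prod>l<N + 2. f l (y l)) = (\<Prod>l<Suc N. f l (y l))"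
      by (simp add: f_def)
    also have "\<dots> = f 0 (y 0) * (\<Prod>k=1..N. f k (y k))"
      by (rule prod_lessThan_Suc_head)
    also have "\<dots> = coin_kernel n N y t"
      unfolding coin_kernel_def by (intro arg_cong2[of _ _ _ _ "(*)"] prod.cong) (auto simp: f_def)
    finally show ?thesis ..
  qed
  then have "coin_avg (N + 2) (\<lambda>y. coin_kernel n N y t) = (\<Prod>l<N + 2. (f l (1/2) + f l (3/2)) / 2)"
    by (simp only: coin_avg_prod)
  also have "\<dots> = 1"
    by (intro prod.neutral) (auto simp: f_def field_simps)
  finally show ?thesis .
qed

text \<open>The product of the factors at \<open>k \<le> j\<close> is \<open>(1 + e cos x) (1 + cos x)\<close> with \<open>e = 2 (y\<^sub>k - 1)\<close>; its
  constant term is \<open>1 + e/2 = y\<^sub>k\<close>. For \<open>k > j\<close> the constant term is \<open>1\<close>.\<close>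

lemma torus_integral_coin_kernel_riesz:
  assumes n: "lacunary3 n" and j: "j \<le> N"
  shows "(\<integral>t. coin_kernel n N y t * riesz_product n j t \<partial>torus_haar) = prefix_prod y (Suc j)"
proof -
  define a b c where "a k = (if k \<le> j then y k else 1)"
    and "b k = (if k \<le> j then 2 * y k - 1 else 2 * (y k - 1))"
    and "c k = (if k \<le> j then y k - 1 else 0)" for k
  have "coin_kernel n N y t * riesz_product n j t = y 0 *
      (\<Prod>k=1..N. a k + b k * cos (real (n k) * t) + c k * cos (real (2 * n k) * t))" for t
  proof -
    have "riesz_product n j t = (\<Prod>k=1..N. if k \<le> j then 1 + cos (real (n k) * t) else 1)"
      unfolding riesz_product_def using j by (intro prod.mono_neutral_cong_left) auto
    then have "coin_kernel n N y t * riesz_product n j t = y 0 *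
      (\<Prod>k=1..N. (1 + 2 * (y k - 1) * cos (real (n k) * t))
        * (if k \<le> j then 1 + cos (real (n k) * t) else 1))"
      by (simp add: coin_kernel_def prod.distrib)
    also have "\<dots> = y 0 * (\<Prod>k=1..N. a k + b k * cos (real (n k) * t) + c k * cos (real (2 * n k) * t))"
    proof (intro arg_cong2[of _ _ _ _ "(*)"] refl prod.cong)
      fix k
      have double: "cos (real (2 * n k) * t) = 2 * (cos (real (n k) * t))\<^sup>2 - 1"
        using cos_double_cos[of "real (n k) * t"] by (simp add: mult.assoc)
      show "(1 + 2 * (y k - 1) * cos (real (n k) * t)) * (if k \<le> j then 1 + cos (real (n k) * t) else 1)
        = a k + b k * cos (real (n k) * t) + c k * cos (real (2 * n k) * t)"
        unfolding double by (simp add: a_def b_def c_def algebra_simps power2_eq_square)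
    qed
    finally show ?thesis .
  qed
  then have "(\<integral>t. coin_kernel n N y t * riesz_product n j t \<partial>torus_haar) = y 0 * (\<Prod>k=1..N. a k)"
    using cosine_product_mean[where n = n and N = N and a = a and b = b and c = c]
      lacunary3_dominates[OF n] by simp
  also have "(\<Prod>k=1..N. a k) = (\<Prod>k=1..j. y k)"
    using j by (intro prod.mono_neutral_cong_right) (auto simp: a_def)
  also have "y 0 * \<dots> = prefix_prod y (Suc j)"
    by (simp only: prefix_prod_def prod_lessThan_Suc_head)
  finally show ?thesis .
qed

text \<open>Each partial product of coins is the integral of a Riesz product against the kernel. Jensen's
  inequality for the nonnegative kernel and then summation over the coins, under which the kernel
  averages to one, give the claim.\<close>

lemma coin_avg_le_torus_integral:
  assumes q: "seq_seminorm q" and n: "lacunary3 n"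
  shows "coin_avg (N + 2) (\<lambda>y. q (truncate N (\<lambda>j. prefix_prod y (Suc j))))
    \<le> (\<integral>t. q (truncate N (\<lambda>j. riesz_product n j t)) \<partial>torus_haar)"
proof -
  let ?Q = "\<lambda>t. q (truncate N (\<lambda>j. riesz_product n j t))"
  have Q: "continuous_on UNIV ?Q"
    by (intro continuous_on_seq_seminorm_truncate[OF q] continuous_on_riesz_product)
  have int: "integrable torus_haar (\<lambda>t. coin_kernel n N y t * ?Q t)" for y
    by (intro torus_integrable continuous_on_mult continuous_on_coin_kernel Q)
  have "coin_avg (N + 2) (\<lambda>y. q (truncate N (\<lambda>j. prefix_prod y (Suc j))))
      \<le> coin_avg (N + 2) (\<lambda>y. \<integral>t. coin_kernel n N y t * ?Q t \<partial>torus_haar)"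
  proof (rule coin_avg_mono)
    fix y assume y: "y \<in> coins (N + 2)"
    have "truncate N (\<lambda>j. prefix_prod y (Suc j))
        = truncate N (\<lambda>j. \<integral>t. coin_kernel n N y t * riesz_product n j t \<partial>torus_haar)"
      by (simp add: fun_eq_iff torus_integral_coin_kernel_riesz[OF n])
    then have "q (truncate N (\<lambda>j. prefix_prod y (Suc j)))
        = q (truncate N (\<lambda>j. \<integral>t. coin_kernel n N y t * riesz_product n j t \<partial>torus_haar))"
      by (rule arg_cong)
    also have "\<dots> \<le> (\<integral>t. q (truncate N (\<lambda>j. coin_kernel n N y t * riesz_product n j t)) \<partial>torus_haar)"
      by (intro seminorm_torus_integral_le[OF q] continuous_on_mult continuous_on_coin_kernel
          continuous_on_riesz_product)
    also have "\<dots> = (\<integral>t. coin_kernel n N y t * ?Q t \<partial>torus_haar)"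
    proof (intro Bochner_Integration.integral_cong refl)
      fix t
      have "truncate N (\<lambda>j. coin_kernel n N y t * riesz_product n j t)
          = (\<lambda>j. coin_kernel n N y t * truncate N (\<lambda>j. riesz_product n j t) j)"
        by auto
      then show "q (truncate N (\<lambda>j. coin_kernel n N y t * riesz_product n j t))
          = coin_kernel n N y t * ?Q t"
        using coin_kernel_nonneg[OF y] by (simp only: seq_seminorm_scale[OF q] abs_of_nonneg)
    qed
    finally show "q (truncate N (\<lambda>j. prefix_prod y (Suc j)))
        \<le> (\<integral>t. coin_kernel n N y t * ?Q t \<partial>torus_haar)" .
  qed
  also have "\<dots> = (\<integral>t. coin_avg (N + 2) (\<lambda>y. coin_kernel n N y t * ?Q t) \<partial>torus_haar)"
    unfolding coin_avg_def using int by simp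
  also have "\<dots> = (\<integral>t. ?Q t \<partial>torus_haar)"
    by (simp only: coin_avg_mult_right coin_avg_coin_kernel mult_1_left)
  finally show ?thesis .
qed

section \<open>The best constant\<close>

definition admissible_constants :: "real set" where
  "admissible_constants = {c. \<forall>n q N. lacunary3 n \<longrightarrow> seq_seminorm q \<longrightarrow>
     (\<integral>t. q (\<lambda>j. if j \<le> N then riesz_product n j t else 0) \<partial>torus_haar)
       \<ge> c * (\<Sum>j = 0..N. q (\<lambda>i. if i = j then 1 else 0))}"

lemma riesz_c1_eq: "riesz_c1 = Sup admissible_constants"
  by (simp add: riesz_c1_def admissible_constants_def)

lemma admissible_constantsD:
  assumes "c \<in> admissible_constants" "lacunary3 n" "seq_seminorm q"
  shows "c * (\<Sum>j\<le>N. q (unit_seq j)) \<le> (\<integral>t. q (truncate N (\<lambda>j. riesz_product n j t)) \<partial>torus_haar)"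
  using assms unfolding admissible_constants_def by (simp add: atLeast0AtMost)

lemma admissible_constant: "1 / 115200 \<in> admissible_constants"
proof -
  have "1 / 115200 * (\<Sum>j\<le>N. q (unit_seq j))
      \<le> (\<integral>t. q (truncate N (\<lambda>j. riesz_product n j t)) \<partial>torus_haar)"
    if "lacunary3 n" "seq_seminorm q" for n q N
    using coin_avg_seminorm_ge[OF that(2), of N] coin_avg_le_torus_integral[OF that(2,1), of N]
    by simp
  then show ?thesis
    unfolding admissible_constants_def by (simp add: atLeast0AtMost)
qed

text \<open>Without an upper bound the supremum would be an unspecified real number. Already \<open>N = 0\<close> with
  the seminorm \<open>\<bar>x\<^sub>0\<bar>\<close> forces \<open>c \<le> 1\<close>, since \<open>R\<^sub>0 = 1\<close>.\<close>

lemma bdd_above_admissible_constants: "bdd_above admissible_constants"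
proof (rule bdd_aboveI)
  fix c assume c: "c \<in> admissible_constants"
  have "lacunary3 (\<lambda>j. 3 ^ j)" by (simp add: lacunary3_def)
  moreover have "seq_seminorm (\<lambda>x. \<bar>x 0\<bar>)"
    by (simp add: seq_seminorm_def abs_mult abs_triangle_ineq)
  ultimately show "c \<le> 1"
    using admissible_constantsD[OF c, of "\<lambda>j. 3 ^ j" "\<lambda>x. \<bar>x 0\<bar>" 0] torus_integral_const[of 1]
    by (simp add: riesz_product_def del: lebesgue_integral_const)
qed

text \<open>For a given normed space, the seminorm \<open>x \<mapsto> \<parallel>\<Sum>\<^sub>j x\<^sub>j v\<^sub>j\<parallel>\<close> turns the defining property of the
  constant into the inequality for the vectors \<open>v\<^sub>j\<close>, and this property passes from the admissible
  constants to their supremum.\<close>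

theorem theorem2:
  shows "riesz_c1 > 3.1 / 10 ^ 8 \<and>
    (\<forall>n. lacunary3 n \<longrightarrow>
      (\<forall>(v :: nat \<Rightarrow> 'e::real_normed_vector) N.
        (\<integral>t. norm (\<Sum>j = 0..N. riesz_product n j t *\<^sub>R v j) \<partial>torus_haar)
          \<ge> riesz_c1 * (\<Sum>j = 0..N. norm (v j))))"
proof (intro conjI allI impI)
  have "1 / 115200 \<le> riesz_c1"
    unfolding riesz_c1_eq
    by (rule cSup_upper[OF admissible_constant bdd_above_admissible_constants])
  then show "riesz_c1 > 3.1 / 10 ^ 8" by simp
next
  fix n and v :: "nat \<Rightarrow> 'e" and N
  assume n: "lacunary3 n"
  define q where "q x = norm (\<Sum>j\<le>N. x j *\<^sub>R v j)" for x :: "nat \<Rightarrow> real"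
  let ?I = "\<integral>t. norm (\<Sum>j = 0..N. riesz_product n j t *\<^sub>R v j) \<partial>torus_haar"
  let ?S = "\<Sum>j = 0..N. norm (v j)"
  have "seq_seminorm q"
    unfolding seq_seminorm_def q_def
    by (auto simp: scaleR_add_left sum.distrib norm_triangle_ineq simp flip: scaleR_scaleR scaleR_sum_right)
  moreover have "q (unit_seq j) = norm (v j)" if "j \<le> N" for j
    using that by (simp add: q_def if_distrib[of "\<lambda>x. x *\<^sub>R v _"] cong: if_cong)
  moreover have "q (truncate N (\<lambda>j. riesz_product n j t)) = norm (\<Sum>j = 0..N. riesz_product n j t *\<^sub>R v j)" for t
    by (simp add: q_def atLeast0AtMost)
  ultimately have le: "c * ?S \<le> ?I" if "c \<in> admissible_constants" for c
    using admissible_constantsD[OF that n, of q N] by (simp add: atLeast0AtMost)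
  show "riesz_c1 * ?S \<le> ?I"
  proof (cases "?S = 0")
    case True
    then show ?thesis by (simp only: mult_zero_right) (simp add: integral_nonneg_AE)
  next
    case False
    moreover have "?S \<ge> 0" by (intro sum_nonneg norm_ge_zero)
    ultimately have S: "?S > 0" by linarith
    have "riesz_c1 \<le> ?I / ?S"
      unfolding riesz_c1_eq
      by (rule cSup_least) (use admissible_constant le S in \<open>auto simp: pos_le_divide_eq\<close>)
    then show ?thesis using S by (simp add: pos_le_divide_eq)
  qed
qed

end
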